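(* Let $n\ge1$, let $x_1\le x_2\le\cdots\le x_n$ be fixed real numbers, and let $Y_1,\dots,Y_n$ be independent real random variables with arbitrary distributions. Suppose that $f:\mathbb{R}\to[-\infty,\infty]$ is a convex function such that, for each $i$, $f(x_i)$ is a median of $Y_i$. Let $\alpha\in(0,1)$ and let $(\hat L,\hat U)$ be the sign-test band defined in the context from $\mathbf{x}=(x_i)_{i=1}^n$, $\mathbf{Y}=(Y_i)_{i=1}^n$ and $\alpha$. Then $$\mathbb{P}\bigl(\hat L(x)\le f(x)\le\hat U(x)\ \text{for all } x\in\mathbb{R}\bigr)\ge1-\alpha.$$
   Context: Notation: $\bar{\mathbb{R}}=[-\infty,\infty]$. A function $g:\mathbb{R}\to\bar{\mathbb{R}}$ is convex if its epigraph $\{(x,y)\in\mathbb{R}^2: g(x)\le y\}$ is convex. A number $m$ is a median of a random variable $Y$ if $\mathbb{P}(Y\le m)\ge 1/2$ and $\mathbb{P}(Y\ge m)\ge 1/2$. For $\mathbf{x}\in\mathbb{R}^n$, $g(\mathbf{x}):=(g(x_i))_{i=1}^n$. Sign function: $\underline{\mathrm{sign}}(x):=1\{x>0\}-1\{x\le0\}$ for $x\in\bar{\mathbb{R}}$, applied component-wise to vectors. Test statistic: let $\psi(x):=\max(1-|x|,0)$, $\Gamma(u):=(2\log(e/u))^{1/2}$, $\beta_d:=\bigl(\sum_{i=1-d}^{d-1}\psi(i/d)^2\bigr)^{-1/2}$, and for $\boldsymbol{\sigma}\in\{-1,1\}^n$ $$T_{d,j}(\boldsymbol{\sigma}):=\beta_d\sum_{i=1}^n\psi\Bigl(\frac{i-j}{d}\Bigr)\sigma_i,\qquad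 T_o(\boldsymbol{\sigma}):=\max_{d=1,\dots,\lfloor(n+1)/2\rfloor}\Bigl(\max_{j=1,\dots,n}T_{d,j}(\boldsymbol{\sigma})-\Gamma\Bigl(\frac{2d-1}{n}\Bigr)\Bigr).$$ For $\mathbf{v}\in\bar{\mathbb{R}}^n$ let $T(\mathbf{v}):=\max\{T_o(\underline{\mathrm{sign}}(\mathbf{v})),T_o(\underline{\mathrm{sign}}(-\mathbf{v}))\}$. Let $\boldsymbol{\xi}$ be uniformly distributed on $\{-1,1\}^n$, and let $\kappa=\kappa(n,\alpha)$ be the smallest $(1-\alpha)$-quantile of $T(\boldsymbol{\xi})$. Confidence band: suprema and infima of families of functions $\mathbb{R}\to\bar{\mathbb{R}}$ are taken pointwise, and $$\hat U:=\sup\bigl\{g:\mathbb{R}\to\bar{\mathbb{R}}\text{ convex}: T_o(\underline{\mathrm{sign}}(g(\mathbf{x})-\mathbf{Y}))\le\kappa\bigr\},$$ $$\hat L:=\inf\bigl\{g:\mathbb{R}\to\bar{\mathbb{R}}\text{ convex}: g\le\hat U,\ T_o(\underline{\mathrm{sign}}(\mathbf{Y}-g(\mathbf{x})))\le\kappa\bigr\}$$ (the infimum of an empty family is $+\infty$). *)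

theory Defs
  imports "HOL-Probability.Probability"
begin

text \<open>
  Vectors indexed by $1, \dots, n$ are functions on \<^typ>\<open>nat\<close>; only their values
  on \<^term>\<open>{1..n::nat}\<close> matter.
\<close>

definition epigraph :: "(real \<Rightarrow> ereal) \<Rightarrow> (real \<times> real) set" where
  "epigraph g = {(t, y). g t \<le> ereal y}"

definition convex_fun :: "(real \<Rightarrow> ereal) \<Rightarrow> bool" where
  "convex_fun g \<longleftrightarrow> convex (epigraph g)"

definition is_median :: "'a measure \<Rightarrow> ('a \<Rightarrow> real) \<Rightarrow> ereal \<Rightarrow> bool" where
  "is_median M X m \<longleftrightarrow>
     measure M {\<omega> \<in> space M. ereal (X \<omega>) \<le> m} \<ge> 1 / 2 \<and>
     measure M {\<omega> \<in> space M. ereal (X \<omega>) \<ge> m} \<ge> 1 / 2"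

definition is_quantile :: "'a measure \<Rightarrow> ('a \<Rightarrow> real) \<Rightarrow> real \<Rightarrow> real \<Rightarrow> bool" where
  "is_quantile M X p q \<longleftrightarrow>
     measure M {\<omega> \<in> space M. X \<omega> \<le> q} \<ge> p \<and>
     measure M {\<omega> \<in> space M. X \<omega> \<ge> q} \<ge> 1 - p"

definition sign_low :: "ereal \<Rightarrow> real" where
  "sign_low v = of_bool (v > 0) - of_bool (v \<le> 0)"

definition psi :: "real \<Rightarrow> real" where
  "psi t = max (1 - \<bar>t\<bar>) 0"

definition Gam :: "real \<Rightarrow> real" where
  "Gam u = sqrt (2 * ln (exp 1 / u))"

definition beta :: "nat \<Rightarrow> real" where
  "beta d = 1 / sqrt (\<Sum>i \<in> {1 - int d..int d - 1}. (psi (of_int i / real d))\<^sup>2)"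

definition T_loc :: "nat \<Rightarrow> nat \<Rightarrow> nat \<Rightarrow> (nat \<Rightarrow> real) \<Rightarrow> real" where
  "T_loc n d j \<sigma> = beta d * (\<Sum>i = 1..n. psi ((real i - real j) / real d) * \<sigma> i)"

definition T_o :: "nat \<Rightarrow> (nat \<Rightarrow> real) \<Rightarrow> real" where
  "T_o n \<sigma> =
     Max ((\<lambda>d. Max ((\<lambda>j. T_loc n d j \<sigma>) ` {1..n}) - Gam ((2 * real d - 1) / real n))
          ` {1..(n + 1) div 2})"

definition T_stat :: "nat \<Rightarrow> (nat \<Rightarrow> ereal) \<Rightarrow> real" where
  "T_stat n v = max (T_o n (\<lambda>i. sign_low (v i))) (T_o n (\<lambda>i. sign_low (- v i)))"

definition rademacher_vec :: "nat \<Rightarrow> (nat \<Rightarrow> real) pmf" where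
  "rademacher_vec n = pmf_of_set ({1..n} \<rightarrow>\<^sub>E {-1, 1})"

definition kappa :: "nat \<Rightarrow> real \<Rightarrow> real" where
  "kappa n \<alpha> =
     (LEAST q. is_quantile (measure_pmf (rademacher_vec n))
                 (\<lambda>\<xi>. T_stat n (\<lambda>i. ereal (\<xi> i))) (1 - \<alpha>) q)"

text \<open>
  Below, \<^term>\<open>Sup\<close>, \<^term>\<open>Inf\<close> and \<open>\<le>\<close> on functions are the pointwise ones.
\<close>

definition U_hat :: "nat \<Rightarrow> real \<Rightarrow> (nat \<Rightarrow> real) \<Rightarrow> (nat \<Rightarrow> real) \<Rightarrow> real \<Rightarrow> ereal" where
  "U_hat n \<alpha> x y =
     Sup {g. convex_fun g \<and>
             T_o n (\<lambda>i. sign_low (g (x i) - ereal (y i))) \<le> kappa n \<alpha>}"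

definition L_hat :: "nat \<Rightarrow> real \<Rightarrow> (nat \<Rightarrow> real) \<Rightarrow> (nat \<Rightarrow> real) \<Rightarrow> real \<Rightarrow> ereal" where
  "L_hat n \<alpha> x y =
     Inf {g. convex_fun g \<and> g \<le> U_hat n \<alpha> x y \<and>
             T_o n (\<lambda>i. sign_low (ereal (y i) - g (x i))) \<le> kappa n \<alpha>}"

end

theory Submission
  imports Defs
begin

text \<open>
  If \<open>f\<close> passes both sign tests, that is, if \<open>T_stat\<close> of the vector with entries
  \<open>f (x i) - Y i\<close> is at most \<open>kappa\<close>, then \<open>f\<close> itself belongs to the two families whose
  supremum and infimum define the band (\<open>band_covers\<close>). It remains to bound the
  probability of passing, and to know that the coverage event is an event.

  For the probability, medians of real variables are finite, and the sign of \<open>f (x i) - Y i\<close> is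
  positive, and likewise negative, with probability at most one half. Splitting the zeros at
  random turns these signs into independent fair signs (\<open>sign_coupling\<close>). Since \<open>T_o\<close> is
  monotone and a zero counts as \<open>-1\<close> in both tests, the statistic can only grow by this
  (\<open>T_stat_quantile\<close>). So the statistic of the data stays below \<open>kappa\<close> at least as often as
  that of fair signs, which is at least \<open>1 - \<alpha>\<close> once the least quantile is known to exist
  (\<open>kappa_covers\<close>).

  Measurability is needed because \<open>measure\<close> is \<open>0\<close> on sets that are not measurable, so that
  containing an event of large probability is not enough. The band is built from uncountable
  families, but the set of data vectors whose band contains \<open>f\<close> is closed in the product
  topology (\<open>closed_coverage\<close>): at each point the upper bound is upper
  semicontinuous in the data, and the lower bound is lower semicontinuous.
\<close>

section \<open>Monotonicity of the test statistic\<close>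

lemma T_o_mono:
  assumes "n \<ge> 1" and le: "\<And>i. i \<in> {1..n} \<Longrightarrow> \<sigma> i \<le> \<tau> i"
  shows "T_o n \<sigma> \<le> T_o n \<tau>"
proof -
  have loc: "T_loc n d j \<sigma> \<le> T_loc n d j \<tau>" for d j
    unfolding T_loc_def
    by (intro mult_left_mono sum_mono le) (auto simp: psi_def beta_def intro!: sum_nonneg)
  have inner: "Max ((\<lambda>j. T_loc n d j \<sigma>) ` {1..n}) \<le> Max ((\<lambda>j. T_loc n d j \<tau>) ` {1..n})" for d
    using assms(1) by (subst Max_le_iff) (auto intro!: order_trans[OF loc] Max_ge)
  show ?thesis
    unfolding T_o_def
  proof (rule Max.boundedI)
    fix a assume "a \<in> (\<lambda>d. Max ((\<lambda>j. T_loc n d j \<sigma>) ` {1..n}) - Gam ((2 * real d - 1) / real n))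
          ` {1..(n + 1) div 2}"
    then obtain d where d: "d \<in> {1..(n + 1) div 2}"
      and a: "a = Max ((\<lambda>j. T_loc n d j \<sigma>) ` {1..n}) - Gam ((2 * real d - 1) / real n)"
      by auto
    have "a \<le> Max ((\<lambda>j. T_loc n d j \<tau>) ` {1..n}) - Gam ((2 * real d - 1) / real n)"
      unfolding a using inner[of d] by simp
    also have "\<dots> \<le> Max ((\<lambda>d. Max ((\<lambda>j. T_loc n d j \<tau>) ` {1..n}) - Gam ((2 * real d - 1) / real n))
          ` {1..(n + 1) div 2})"
      using d by (intro Max_ge) auto
    finally show "a \<le> \<dots>" .
  qed (use assms(1) in auto)
qed

lemma sign_low_eq: "sign_low v = (if 0 < v then 1 else -1)"
  by (auto simp: sign_low_def)

lemma sign_low_diff_ereal [simp]: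
  "sign_low (a - ereal b) = (if ereal b < a then 1 else -1)"
  "sign_low (ereal b - a) = (if a < ereal b then 1 else -1)"
  by (cases a; auto simp: sign_low_eq)+

lemma T_stat_mono:
  assumes "n \<ge> 1"
    and "\<And>i. i \<in> {1..n} \<Longrightarrow> sign_low (v i) \<le> sign_low (w i)"
    and "\<And>i. i \<in> {1..n} \<Longrightarrow> sign_low (- v i) \<le> sign_low (- w i)"
  shows "T_stat n v \<le> T_stat n w"
  unfolding T_stat_def using assms by (intro max.mono T_o_mono) auto

section \<open>The critical value\<close>

text \<open>
  A down-closed event for \<open>X\<close> is decided by the largest value of \<open>X\<close> satisfying it; this lets
  both one-sided distribution functions be evaluated at values that are attained.
\<close>

lemma prob_down_closed_attained:
  fixes X :: "'b \<Rightarrow> real"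
  assumes fin: "finite (set_pmf p)"
    and down: "\<And>a b. a \<le> b \<Longrightarrow> D b \<Longrightarrow> D a"
    and pos: "0 < measure_pmf.prob p {w. D (X w)}"
  obtains v where "v \<in> X ` set_pmf p" "D v"
    "measure_pmf.prob p {w. X w \<le> v} = measure_pmf.prob p {w. D (X w)}"
proof -
  let ?V = "{v \<in> X ` set_pmf p. D v}"
  have "?V \<noteq> {}"
  proof
    assume "?V = {}"
    then have "{w. D (X w)} \<inter> set_pmf p = {}" by auto
    then show False
      using pos measure_Int_set_pmf[of p "{w. D (X w)}"] by simp
  qed
  then have V: "Max ?V \<in> ?V" using fin by (intro Max_in) auto
  have "{w. X w \<le> Max ?V} \<inter> set_pmf p = {w. D (X w)} \<inter> set_pmf p"
    using V down fin by (auto intro!: Max_ge)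
  then have "measure_pmf.prob p {w. X w \<le> Max ?V} = measure_pmf.prob p {w. D (X w)}"
    by (metis measure_Int_set_pmf)
  with V that show ?thesis by blast
qed

text \<open>
  The least quantile exists because \<open>X\<close> takes finitely many values: it is the least value at
  which the distribution function reaches \<open>r\<close>. Without existence \<open>LEAST\<close> would be arbitrary.
\<close>

lemma cdf_at_least_quantile:
  fixes X :: "'b \<Rightarrow> real"
  assumes fin: "finite (set_pmf p)" and r: "0 < r" "r \<le> 1"
  shows "r \<le> measure_pmf.prob p {w. X w \<le> (LEAST q. is_quantile (measure_pmf p) X r q)}"
proof -
  let ?F = "\<lambda>q. measure_pmf.prob p {w. X w \<le> q}"
  define S where "S = {v \<in> X ` set_pmf p. r \<le> ?F v}"
  have "measure_pmf.prob p {w. True} = 1"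
    using measure_pmf.prob_space[of p] by simp
  then obtain v where "v \<in> X ` set_pmf p" "?F v = 1"
    using prob_down_closed_attained[of p "\<lambda>_. True" X] fin by (auto simp del: measure_pmf_UNIV)
  then have "v \<in> S" using r by (simp add: S_def)
  then have "S \<noteq> {}" by blast
  have finS: "finite S" using fin by (simp add: S_def)
  have Min: "Min S \<in> S" using finS \<open>S \<noteq> {}\<close> by (rule Min_in)
  have lower: "Min S \<le> q" if "r \<le> ?F q" for q
  proof -
    have "0 < ?F q" using r that by linarith
    then obtain v where "v \<in> X ` set_pmf p" "v \<le> q" "?F v = ?F q"
      using prob_down_closed_attained[of p "\<lambda>a. a \<le> q" X] fin by auto
    then have "v \<in> S" using that by (auto simp: S_def)
    then show ?thesis using finS \<open>v \<le> q\<close> by (meson Min_le order_trans)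
  qed
  have strict: "measure_pmf.prob p {w. X w < Min S} < r"
  proof (rule ccontr)
    assume *: "\<not> ?thesis"
    then have "0 < measure_pmf.prob p {w. X w < Min S}" using r by linarith
    then obtain v where "v < Min S" "?F v = measure_pmf.prob p {w. X w < Min S}"
      using prob_down_closed_attained[of p "\<lambda>a. a < Min S" X] fin by auto
    then show False using lower[of v] * by linarith
  qed
  have "measure_pmf.prob p {w. Min S \<le> X w} = 1 - measure_pmf.prob p {w. X w < Min S}"
    by (subst measure_pmf.prob_compl[symmetric]) (auto intro!: arg_cong[where f="measure_pmf.prob p"])
  then have "is_quantile (measure_pmf p) X r (Min S)"
    using strict Min by (simp add: is_quantile_def S_def)
  then have "(LEAST q. is_quantile (measure_pmf p) X r q) = Min S"
    by (rule Least_equality) (simp add: is_quantile_def lower)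
  then show ?thesis using Min by (simp add: S_def)
qed

lemma finite_sign_vectors: "finite ({1..n::nat} \<rightarrow>\<^sub>E {-1, 1::real})"
  by (intro finite_PiE) auto

lemma kappa_covers:
  assumes "0 < \<alpha>" "\<alpha> < 1"
  shows "1 - \<alpha> \<le> measure_pmf.prob (rademacher_vec n)
           {\<xi>. T_stat n (\<lambda>i. ereal (\<xi> i)) \<le> kappa n \<alpha>}"
  unfolding kappa_def
proof (rule cdf_at_least_quantile)
  have "{1..n::nat} \<rightarrow>\<^sub>E {-1, 1::real} \<noteq> {}" by (simp add: PiE_eq_empty_iff)
  then show "finite (set_pmf (rademacher_vec n))"
    using finite_sign_vectors by (simp add: rademacher_vec_def)
qed (use assms in auto)

section \<open>Coupling three-valued signs with fair signs\<close>

text \<open>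
  A sign that is positive and negative with probability at most one half each becomes a fair
  sign when its zero is split at random. The table of joint probabilities \<open>w i t s\<close> of old and
  new sign carries out this coupling by sums over finite sets, without enlarging the
  probability space: it vanishes unless \<open>t = 0\<close> or \<open>t = s\<close>, so that \<open>P\<close> can be moved from the
  new sign vector to the old one.
\<close>

lemma (in prob_space) sign_coupling:
  fixes X :: "nat \<Rightarrow> 'a \<Rightarrow> real"
  assumes I: "finite I" "I \<noteq> {}"
    and indep: "indep_vars (\<lambda>_. borel) X I"
    and vals: "\<And>i \<omega>. i \<in> I \<Longrightarrow> X i \<omega> \<in> {-1, 0, 1}"
    and pos: "\<And>i. i \<in> I \<Longrightarrow> prob {\<omega> \<in> space M. X i \<omega> = 1} \<le> 1 / 2"
    and neg: "\<And>i. i \<in> I \<Longrightarrow> prob {\<omega> \<in> space M. X i \<omega> = -1} \<le> 1 / 2"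
    and transfer: "\<And>\<tau> \<sigma>. (\<And>i. i \<in> I \<Longrightarrow> \<tau> i = 0 \<or> \<tau> i = \<sigma> i) \<Longrightarrow> \<sigma> \<in> I \<rightarrow>\<^sub>E {-1, 1} \<Longrightarrow>
        P \<sigma> \<Longrightarrow> P \<tau>"
  shows "measure_pmf.prob (pmf_of_set (I \<rightarrow>\<^sub>E {-1, 1})) {\<sigma>. P \<sigma>}
           \<le> prob {\<omega> \<in> space M. P (restrict (\<lambda>i. X i \<omega>) I)}"
proof -
  let ?S = "I \<rightarrow>\<^sub>E {-1, 1::real}" and ?R = "I \<rightarrow>\<^sub>E {-1, 0, 1::real}"
  define q where "q i t = prob {\<omega> \<in> space M. X i \<omega> = t}" for i t
  \<comment> \<open>The zero is split so that each new sign receives what \<open>q\<close> lacks to one half.\<close>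
  define w where "w i t s = (if t = 0 then 1 / 2 - q i s else if t = s then q i t else 0)"
    for i and t s :: real
  have meas [measurable]: "X i \<in> borel_measurable M" if "i \<in> I" for i
    using indep that by (auto simp: indep_vars_def)
  have fin: "finite ?S" "finite ?R" using I by (auto intro!: finite_PiE)
  have ne: "?S \<noteq> {}" by (simp add: PiE_eq_empty_iff)
  have total: "q i 0 = 1 - q i 1 - q i (-1)" if "i \<in> I" for i
  proof -
    have [measurable]: "X i \<in> borel_measurable M" using that by simp
    have "space M = (\<Union>t\<in>{-1, 0, 1}. {\<omega> \<in> space M. X i \<omega> = t})"
      using vals[OF that] by fastforce
    then have "1 = prob (\<Union>t\<in>{-1, 0, 1}. {\<omega> \<in> space M. X i \<omega> = t})"
      using prob_space by simp
    also have "\<dots> = (\<Sum>t\<in>{-1, 0, 1}. q i t)"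
      unfolding q_def
      by (rule finite_measure_finite_Union) (auto simp: disjoint_family_on_def)
    finally show ?thesis by simp
  qed
  have w_nonneg: "0 \<le> w i t s" if "i \<in> I" "s \<in> {-1, 1}" for i t s
    using that pos[OF that(1)] neg[OF that(1)] by (auto simp: w_def q_def)
  have marg1: "(\<Sum>s\<in>{-1, 1}. w i t s) = q i t" if "i \<in> I" "t \<in> {-1, 0, 1}" for i t
    using that total[OF that(1)] by (auto simp: w_def)
  have marg2: "(\<Sum>t\<in>{-1, 0, 1}. w i t s) = 1 / 2" if "s \<in> {-1, 1}" for i s
    using that by (auto simp: w_def)
  let ?E = "\<lambda>\<tau>. {\<omega> \<in> space M. restrict (\<lambda>i. X i \<omega>) I = \<tau>}"
  have E_eq: "?E \<tau> = (\<Inter>i\<in>I. X i -` {\<tau> i} \<inter> space M)" if "\<tau> \<in> ?R" for \<tau>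
    using that I(2) by (auto simp: restrict_def PiE_iff extensional_def fun_eq_iff)
  have E_sets: "?E \<tau> \<in> events" if "\<tau> \<in> ?R" for \<tau>
    unfolding E_eq[OF that] using I by (intro sets.finite_INT measurable_sets[OF meas]) auto
  have law: "prob (?E \<tau>) = (\<Sum>\<sigma>\<in>?S. \<Prod>i\<in>I. w i (\<tau> i) (\<sigma> i))" if "\<tau> \<in> ?R" for \<tau>
  proof -
    have "prob (?E \<tau>) = (\<Prod>i\<in>I. prob (X i -` {\<tau> i} \<inter> space M))"
      unfolding E_eq[OF that] using I by (intro indep_varsD_finite[OF indep]) auto
    also have "\<dots> = (\<Prod>i\<in>I. q i (\<tau> i))"
      unfolding q_def by (intro prod.cong refl arg_cong[where f=prob]) auto
    also have "\<dots> = (\<Prod>i\<in>I. \<Sum>s\<in>{-1, 1}. w i (\<tau> i) s)"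
      using that by (intro prod.cong refl marg1[symmetric]) auto
    also have "\<dots> = (\<Sum>\<sigma>\<in>?S. \<Prod>i\<in>I. w i (\<tau> i) (\<sigma> i))"
      using I by (intro prod_sum_PiE) auto
    finally show ?thesis .
  qed
  have fair: "(\<Sum>\<tau>\<in>?R. \<Prod>i\<in>I. w i (\<tau> i) (\<sigma> i)) = (1 / 2) ^ card I" if "\<sigma> \<in> ?S" for \<sigma>
  proof -
    have "(\<Sum>\<tau>\<in>?R. \<Prod>i\<in>I. w i (\<tau> i) (\<sigma> i)) = (\<Prod>i\<in>I. \<Sum>t\<in>{-1, 0, 1}. w i t (\<sigma> i))"
      using I by (intro prod_sum_PiE[symmetric]) auto
    also have "\<dots> = (\<Prod>i\<in>I. 1 / 2)"
      using that by (intro prod.cong refl marg2) auto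
    finally show ?thesis by simp
  qed
  have "measure_pmf.prob (pmf_of_set ?S) {\<sigma>. P \<sigma>} = (\<Sum>\<sigma>\<in>{\<sigma>\<in>?S. P \<sigma>}. (1 / 2) ^ card I)"
    using I ne fin by (simp add: measure_pmf_of_set card_PiE power_divide Int_def)
  also have "\<dots> = (\<Sum>\<sigma>\<in>{\<sigma>\<in>?S. P \<sigma>}. \<Sum>\<tau>\<in>?R. \<Prod>i\<in>I. w i (\<tau> i) (\<sigma> i))"
    by (intro sum.cong refl fair[symmetric]) auto
  also have "\<dots> = (\<Sum>\<tau>\<in>?R. \<Sum>\<sigma>\<in>{\<sigma>\<in>?S. P \<sigma>}. \<Prod>i\<in>I. w i (\<tau> i) (\<sigma> i))"
    by (rule sum.swap)
  also have "\<dots> = (\<Sum>\<tau>\<in>{\<tau>\<in>?R. P \<tau>}. \<Sum>\<sigma>\<in>{\<sigma>\<in>?S. P \<sigma>}. \<Prod>i\<in>I. w i (\<tau> i) (\<sigma> i))"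
  proof (rule sum.mono_neutral_right)
    show "\<forall>\<tau>\<in>?R - {\<tau>\<in>?R. P \<tau>}. (\<Sum>\<sigma>\<in>{\<sigma>\<in>?S. P \<sigma>}. \<Prod>i\<in>I. w i (\<tau> i) (\<sigma> i)) = 0"
    proof (intro ballI sum.neutral)
      fix \<tau> \<sigma> assume "\<tau> \<in> ?R - {\<tau>\<in>?R. P \<tau>}" "\<sigma> \<in> {\<sigma>\<in>?S. P \<sigma>}"
      then obtain i where "i \<in> I" "\<tau> i \<noteq> 0" "\<tau> i \<noteq> \<sigma> i"
        using transfer[of \<tau> \<sigma>] by blast
      then show "(\<Prod>i\<in>I. w i (\<tau> i) (\<sigma> i)) = 0"
        using I by (auto simp: w_def)
    qed
  qed (use fin in auto)
  also have "\<dots> \<le> (\<Sum>\<tau>\<in>{\<tau>\<in>?R. P \<tau>}. prob (?E \<tau>))"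
    using fin by (intro sum_mono) (auto simp: law intro!: sum_mono2 prod_nonneg w_nonneg)
  also have "\<dots> = prob (\<Union>\<tau>\<in>{\<tau>\<in>?R. P \<tau>}. ?E \<tau>)"
    using fin E_sets
    by (intro finite_measure_finite_Union[symmetric]) (auto simp: disjoint_family_on_def)
  also have "(\<Union>\<tau>\<in>{\<tau>\<in>?R. P \<tau>}. ?E \<tau>) = {\<omega> \<in> space M. P (restrict (\<lambda>i. X i \<omega>) I)}"
    using vals by (auto simp: PiE_iff)
  finally show ?thesis .
qed

section \<open>Perturbing the data\<close>

lemma convex_fun_iff:
  "convex_fun g \<longleftrightarrow> (\<forall>s t a b u v. g s \<le> ereal a \<longrightarrow> g t \<le> ereal b \<longrightarrow> 0 \<le> u \<longrightarrow> 0 \<le> v \<longrightarrow>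
     u + v = 1 \<longrightarrow> g (u * s + v * t) \<le> ereal (u * a + v * b))"
  unfolding convex_fun_def epigraph_def convex_def by auto

lemma convex_fun_shift:
  assumes "convex_fun g"
  shows "convex_fun (\<lambda>t. g t - ereal \<epsilon>)"
  unfolding convex_fun_iff
proof (intro allI impI)
  fix s t a b u v :: real
  assume "g s - ereal \<epsilon> \<le> ereal a" "g t - ereal \<epsilon> \<le> ereal b" and uv: "0 \<le> u" "0 \<le> v" "u + v = 1"
  then have "g s \<le> ereal (a + \<epsilon>)" "g t \<le> ereal (b + \<epsilon>)"
    by (simp_all add: ereal_minus_le_iff add.commute)
  then have "g (u * s + v * t) \<le> ereal (u * (a + \<epsilon>) + v * (b + \<epsilon>))"
    using assms uv unfolding convex_fun_iff by blast
  also have "u * (a + \<epsilon>) + v * (b + \<epsilon>) = u * a + v * b + (u + v) * \<epsilon>"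
    by (simp add: algebra_simps)
  finally show "g (u * s + v * t) - ereal \<epsilon> \<le> ereal (u * a + v * b)"
    using uv by (simp add: ereal_minus_le_iff add.commute)
qed

lemma convex_fun_limsup:
  assumes "\<And>k. convex_fun (g k)"
  shows "convex_fun (\<lambda>t. limsup (\<lambda>k. g k t))"
  unfolding convex_fun_iff
proof (intro allI impI)
  fix s t a b u v :: real
  assume st: "limsup (\<lambda>k. g k s) \<le> ereal a" "limsup (\<lambda>k. g k t) \<le> ereal b"
    and uv: "0 \<le> u" "0 \<le> v" "u + v = 1"
  show "limsup (\<lambda>k. g k (u * s + v * t)) \<le> ereal (u * a + v * b)"
  proof (rule ereal_le_epsilon2)
    fix e :: real assume "0 < e"
    have "\<forall>\<^sub>F k in sequentially. g k s < ereal (a + e)" "\<forall>\<^sub>F k in sequentially. g k t < ereal (b + e)"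
      using st \<open>0 < e\<close> by (auto intro!: Limsup_lessD elim!: le_less_trans)
    then have "\<forall>\<^sub>F k in sequentially. g k (u * s + v * t) \<le> ereal (u * a + v * b) + ereal e"
    proof eventually_elim
      case (elim k)
      then have "g k (u * s + v * t) \<le> ereal (u * (a + e) + v * (b + e))"
        using assms[of k] uv unfolding convex_fun_iff by (meson less_imp_le)
      also have "u * (a + e) + v * (b + e) = u * a + v * b + (u + v) * e"
        by (simp add: algebra_simps)
      finally show ?case using uv by simp
    qed
    then show "limsup (\<lambda>k. g k (u * s + v * t)) \<le> ereal (u * a + v * b) + ereal e"
      by (rule Limsup_bounded)
  qed
qed

text \<open>
  The upper bound is equivariant under vertical translation and monotone in the data, hence
  Lipschitz for the supremum norm.
\<close>

lemma U_hat_perturb: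
  assumes "n \<ge> 1" and close: "\<And>i. i \<in> {1..n} \<Longrightarrow> z i \<le> y i + \<epsilon>"
  shows "U_hat n \<alpha> x z t \<le> U_hat n \<alpha> x y t + ereal \<epsilon>"
  unfolding U_hat_def[of n \<alpha> x z] Sup_apply
proof (rule SUP_least)
  fix g assume "g \<in> {g. convex_fun g \<and> T_o n (\<lambda>i. sign_low (g (x i) - ereal (z i))) \<le> kappa n \<alpha>}"
  then have g: "convex_fun g" "T_o n (\<lambda>i. sign_low (g (x i) - ereal (z i))) \<le> kappa n \<alpha>" by auto
  let ?h = "\<lambda>t. g t - ereal \<epsilon>"
  have "T_o n (\<lambda>i. sign_low (?h (x i) - ereal (y i)))
      \<le> T_o n (\<lambda>i. sign_low (g (x i) - ereal (z i)))"
  proof (rule T_o_mono[OF assms(1)])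
    fix i assume i: "i \<in> {1..n}"
    have "ereal (z i) < g (x i)" if "ereal (y i) < ?h (x i)"
      using that close[OF i] by (cases "g (x i)") auto
    then show "sign_low (?h (x i) - ereal (y i)) \<le> sign_low (g (x i) - ereal (z i))"
      by auto
  qed
  then have "?h \<in> {g. convex_fun g \<and> T_o n (\<lambda>i. sign_low (g (x i) - ereal (y i))) \<le> kappa n \<alpha>}"
    using g convex_fun_shift by auto
  then have "?h \<le> U_hat n \<alpha> x y" unfolding U_hat_def by (rule Sup_upper)
  then have "g t - ereal \<epsilon> \<le> U_hat n \<alpha> x y t" by (rule le_funD)
  then show "g t \<le> U_hat n \<alpha> x y t + ereal \<epsilon>"
    by (simp add: ereal_minus_le_iff add.commute)
qed

lemma U_hat_eventually_le:
  assumes "n \<ge> 1" and lim: "\<And>i. i \<in> {1..n} \<Longrightarrow> (\<lambda>k. z k i) \<longlonglongrightarrow> y i" and "0 < \<epsilon>"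
  shows "\<forall>\<^sub>F k in sequentially. \<forall>t. U_hat n \<alpha> x (z k) t \<le> U_hat n \<alpha> x y t + ereal \<epsilon>"
proof -
  have "\<forall>\<^sub>F k in sequentially. \<forall>i\<in>{1..n}. z k i < y i + \<epsilon>"
  proof (intro eventually_ball_finite ballI)
    fix i assume "i \<in> {1..n}"
    from lim[OF this] show "\<forall>\<^sub>F k in sequentially. z k i < y i + \<epsilon>"
      using \<open>0 < \<epsilon>\<close> by (intro order_tendstoD(2)) auto
  qed simp
  then show ?thesis
    by eventually_elim (intro allI U_hat_perturb[OF assms(1)], simp add: less_imp_le)
qed

lemma U_hat_upper_semicontinuous:
  assumes "n \<ge> 1" and "\<And>i. i \<in> {1..n} \<Longrightarrow> (\<lambda>k. z k i) \<longlonglongrightarrow> y i"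
    and "\<And>k. c \<le> U_hat n \<alpha> x (z k) t"
  shows "c \<le> U_hat n \<alpha> x y t"
proof (rule ereal_le_epsilon2)
  fix e :: real assume "0 < e"
  have "\<forall>\<^sub>F k in sequentially. \<forall>t. U_hat n \<alpha> x (z k) t \<le> U_hat n \<alpha> x y t + ereal e"
    by (intro U_hat_eventually_le assms \<open>0 < e\<close>)
  then obtain k where "U_hat n \<alpha> x (z k) t \<le> U_hat n \<alpha> x y t + ereal e"
    unfolding eventually_sequentially by blast
  with assms(3)[of k] show "c \<le> U_hat n \<alpha> x y t + ereal e" by (rule order_trans)
qed

text \<open>
  The lower bound is neither monotone nor Lipschitz in the data, because raising the data relaxes
  the constraint \<open>g \<le> U_hat\<close> and tightens the one on the signs. Lower semicontinuity survives:
  the upper limit of competitors for the approximating data is a competitor for the limit data.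
  Convexity passes to an upper limit, the bound by \<open>U_hat\<close> is Lipschitz, and a datum strictly
  above the upper limit is eventually strictly above the approximating competitors.
\<close>

lemma L_hat_lower_semicontinuous:
  assumes "n \<ge> 1" and lim: "\<And>i. i \<in> {1..n} \<Longrightarrow> (\<lambda>k. z k i) \<longlonglongrightarrow> y i"
    and le: "\<And>k. L_hat n \<alpha> x (z k) t \<le> c"
  shows "L_hat n \<alpha> x y t \<le> c"
proof (rule dense_ge)
  fix b assume "c < b"
  have "\<exists>g. convex_fun g \<and> g \<le> U_hat n \<alpha> x (z k) \<and>
          T_o n (\<lambda>i. sign_low (ereal (z k i) - g (x i))) \<le> kappa n \<alpha> \<and> g t < b" for k
  proof -
    have "L_hat n \<alpha> x (z k) t < b" using le[of k] \<open>c < b\<close> by (rule le_less_trans)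
    then show ?thesis unfolding L_hat_def Inf_apply INF_less_iff by blast
  qed
  then obtain g where conv: "\<And>k. convex_fun (g k)"
    and below: "\<And>k. g k \<le> U_hat n \<alpha> x (z k)"
    and signs: "\<And>k. T_o n (\<lambda>i. sign_low (ereal (z k i) - g k (x i))) \<le> kappa n \<alpha>"
    and less: "\<And>k. g k t < b"
    by metis
  define h where "h s = limsup (\<lambda>k. g k s)" for s
  have "convex_fun h" unfolding h_def using conv by (rule convex_fun_limsup)
  moreover have "h \<le> U_hat n \<alpha> x y"
  proof (rule le_funI, rule ereal_le_epsilon2)
    fix s and e :: real assume "0 < e"
    have "\<forall>\<^sub>F k in sequentially. \<forall>t. U_hat n \<alpha> x (z k) t \<le> U_hat n \<alpha> x y t + ereal e"
      by (intro U_hat_eventually_le assms \<open>0 < e\<close>)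
    then have "\<forall>\<^sub>F k in sequentially. g k s \<le> U_hat n \<alpha> x y s + ereal e"
      by eventually_elim (meson below le_funD order_trans)
    then show "h s \<le> U_hat n \<alpha> x y s + ereal e" unfolding h_def by (rule Limsup_bounded)
  qed
  moreover have "T_o n (\<lambda>i. sign_low (ereal (y i) - h (x i))) \<le> kappa n \<alpha>"
  proof -
    have "\<forall>\<^sub>F k in sequentially. h (x i) < ereal (y i) \<longrightarrow> g k (x i) < ereal (z k i)"
      if i: "i \<in> {1..n}" for i
    proof (cases "h (x i) < ereal (y i)")
      case True
      then obtain r where r: "h (x i) < ereal r" "r < y i"
        using ereal_dense2 by force
      have "\<forall>\<^sub>F k in sequentially. g k (x i) < ereal r"
        using r(1) unfolding h_def by (rule Limsup_lessD)
      moreover have "\<forall>\<^sub>F k in sequentially. r < z k i"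
        using lim[OF i] r(2) by (rule order_tendstoD)
      ultimately show ?thesis
        by eventually_elim (metis less_ereal.simps(1) less_trans)
    qed simp
    then have "\<forall>\<^sub>F k in sequentially. \<forall>i\<in>{1..n}. h (x i) < ereal (y i) \<longrightarrow> g k (x i) < ereal (z k i)"
      by (intro eventually_ball_finite) auto
    then obtain k where k: "\<And>i. i \<in> {1..n} \<Longrightarrow> h (x i) < ereal (y i) \<Longrightarrow> g k (x i) < ereal (z k i)"
      unfolding eventually_sequentially by blast
    have "T_o n (\<lambda>i. sign_low (ereal (y i) - h (x i)))
        \<le> T_o n (\<lambda>i. sign_low (ereal (z k i) - g k (x i)))"
      by (rule T_o_mono[OF assms(1)]) (use k in auto)
    then show ?thesis using signs[of k] by (rule order_trans)
  qed
  ultimately have "L_hat n \<alpha> x y \<le> h" unfolding L_hat_def by (intro Inf_lower) auto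
  then have "L_hat n \<alpha> x y t \<le> h t" by (rule le_funD)
  also have "h t \<le> b" unfolding h_def
    by (rule Limsup_bounded) (simp add: less less_imp_le)
  finally show "L_hat n \<alpha> x y t \<le> b" .
qed

section \<open>The coverage event\<close>

lemma closed_coverage:
  assumes "n \<ge> 1"
  shows "closed {y. \<forall>t. L_hat n \<alpha> x y t \<le> f t \<and> f t \<le> U_hat n \<alpha> x y t}"
  unfolding closed_sequential_limits
proof (intro allI impI)
  fix z y
  assume "(\<forall>k. z k \<in> {y. \<forall>t. L_hat n \<alpha> x y t \<le> f t \<and> f t \<le> U_hat n \<alpha> x y t}) \<and> z \<longlonglongrightarrow> y"
  then have z: "\<And>k t. L_hat n \<alpha> x (z k) t \<le> f t" "\<And>k t. f t \<le> U_hat n \<alpha> x (z k) t"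
    and "z \<longlonglongrightarrow> y"
    by auto
  have lim: "(\<lambda>k. z k i) \<longlonglongrightarrow> y i" for i
    using continuous_on_tendsto_compose[OF continuous_on_product_coordinates \<open>z \<longlonglongrightarrow> y\<close>, of i]
    by simp
  have "L_hat n \<alpha> x y t \<le> f t" for t
    by (rule L_hat_lower_semicontinuous[OF assms, where z=z]) (rule lim z(1))+
  moreover have "f t \<le> U_hat n \<alpha> x y t" for t
    by (rule U_hat_upper_semicontinuous[OF assms, where z=z]) (rule lim z(2))+
  ultimately show "y \<in> {y. \<forall>t. L_hat n \<alpha> x y t \<le> f t \<and> f t \<le> U_hat n \<alpha> x y t}"
    by blast
qed

lemma band_cong:
  assumes "n \<ge> 1" and eq: "\<And>i. i \<in> {1..n} \<Longrightarrow> y i = z i"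
  shows "U_hat n \<alpha> x y = U_hat n \<alpha> x z" "L_hat n \<alpha> x y = L_hat n \<alpha> x z"
proof -
  have "T_o n (\<lambda>i. sign_low (g (x i) - ereal (y i))) = T_o n (\<lambda>i. sign_low (g (x i) - ereal (z i)))"
    "T_o n (\<lambda>i. sign_low (ereal (y i) - g (x i))) = T_o n (\<lambda>i. sign_low (ereal (z i) - g (x i)))" for g
    by (intro antisym T_o_mono[OF assms(1)]; simp add: eq)+
  then show "U_hat n \<alpha> x y = U_hat n \<alpha> x z" "L_hat n \<alpha> x y = L_hat n \<alpha> x z"
    unfolding L_hat_def U_hat_def by simp_all
qed

lemma (in prob_space) coverage_event:
  assumes "n \<ge> 1" and meas: "\<And>i. i \<in> {1..n} \<Longrightarrow> random_variable borel (Y i)"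
  shows "{\<omega> \<in> space M. \<forall>t. L_hat n \<alpha> x (\<lambda>i. Y i \<omega>) t \<le> f t \<and> f t \<le> U_hat n \<alpha> x (\<lambda>i. Y i \<omega>) t} \<in> events"
proof -
  \<comment> \<open>The variables \<open>Y i\<close> with \<open>i\<close> outside the index range need not be measurable.\<close>
  define Z where "Z \<omega> i = (if i \<in> {1..n} then Y i \<omega> else 0)" for \<omega> i
  have "(\<lambda>\<omega>. Z \<omega> i) \<in> borel_measurable M" for i
    unfolding Z_def using meas[of i] by (cases "i \<in> {1..n}") (simp_all only: if_True if_False, simp)
  then have [measurable]: "Z \<in> borel_measurable M"
    by (rule measurable_coordinatewise_then_product)
  let ?A = "{y. \<forall>t. L_hat n \<alpha> x y t \<le> f t \<and> f t \<le> U_hat n \<alpha> x y t}"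
  have "Z -` ?A \<inter> space M \<in> events"
    by (rule measurable_sets[OF _ borel_closed[OF closed_coverage[OF assms(1)]]]) measurable
  moreover have "U_hat n \<alpha> x (Z \<omega>) = U_hat n \<alpha> x (\<lambda>i. Y i \<omega>)"
    "L_hat n \<alpha> x (Z \<omega>) = L_hat n \<alpha> x (\<lambda>i. Y i \<omega>)" for \<omega>
    by (auto intro!: band_cong[OF assms(1)] simp: Z_def)
  then have "Z -` ?A \<inter> space M = {\<omega> \<in> space M. \<forall>t. L_hat n \<alpha> x (\<lambda>i. Y i \<omega>) t \<le> f t
      \<and> f t \<le> U_hat n \<alpha> x (\<lambda>i. Y i \<omega>) t}"
    by auto
  ultimately show ?thesis by simp
qed

lemma band_covers:
  assumes "convex_fun f" and stat: "T_stat n (\<lambda>i. f (x i) - ereal (y i)) \<le> kappa n \<alpha>"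
  shows "L_hat n \<alpha> x y t \<le> f t" "f t \<le> U_hat n \<alpha> x y t"
proof -
  have "- (f (x i) - ereal (y i)) = ereal (y i) - f (x i)" for i
    by (cases "f (x i)") auto
  then have up: "T_o n (\<lambda>i. sign_low (f (x i) - ereal (y i))) \<le> kappa n \<alpha>"
    and low: "T_o n (\<lambda>i. sign_low (ereal (y i) - f (x i))) \<le> kappa n \<alpha>"
    using stat unfolding T_stat_def by simp_all
  have U: "f \<le> U_hat n \<alpha> x y"
    unfolding U_hat_def using assms(1) up by (intro Sup_upper) auto
  then show "f t \<le> U_hat n \<alpha> x y t" by (rule le_funD)
  have "L_hat n \<alpha> x y \<le> f"
    unfolding L_hat_def using assms(1) low U by (intro Inf_lower) auto
  then show "L_hat n \<alpha> x y t \<le> f t" by (rule le_funD)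
qed

lemma (in prob_space) median_real:
  assumes "is_median M X m"
  obtains r where "m = ereal r"
  using assms by (cases m) (auto simp: is_median_def)

text \<open>
  Both \<open>sign_low v\<close> and \<open>sign_low (- v)\<close> are \<open>-1\<close> at \<open>v = 0\<close>, so that replacing a zero by
  either sign cannot decrease \<open>T_stat\<close>. This is what the coupling of the signs of \<open>F i - Y i\<close>
  with fair signs requires.
\<close>

lemma (in prob_space) T_stat_quantile:
  fixes Y :: "nat \<Rightarrow> 'a \<Rightarrow> real"
  assumes "n \<ge> 1" and indep: "indep_vars (\<lambda>_. borel) Y {1..n}"
    and med: "\<And>i. i \<in> {1..n} \<Longrightarrow> is_median M (Y i) (ereal (F i))"
  shows "measure_pmf.prob (rademacher_vec n) {\<xi>. T_stat n (\<lambda>i. ereal (\<xi> i)) \<le> c}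
      \<le> prob {\<omega> \<in> space M. T_stat n (\<lambda>i. ereal (F i - Y i \<omega>)) \<le> c}"
proof -
  let ?X = "\<lambda>i \<omega>. sgn (F i - Y i \<omega>)"
  have meas: "Y i \<in> borel_measurable M" if "i \<in> {1..n}" for i
    using indep that by (auto simp: indep_vars_def)
  have T_sgn: "T_stat n (\<lambda>i. ereal (restrict (\<lambda>i. ?X i \<omega>) {1..n} i))
      = T_stat n (\<lambda>i. ereal (F i - Y i \<omega>))" for \<omega>
    by (intro antisym T_stat_mono[OF assms(1)]) (auto simp: sign_low_eq sgn_if)
  have "measure_pmf.prob (pmf_of_set ({1..n} \<rightarrow>\<^sub>E {-1, 1})) {\<xi>. T_stat n (\<lambda>i. ereal (\<xi> i)) \<le> c}
      \<le> prob {\<omega> \<in> space M. T_stat n (\<lambda>i. ereal (restrict (\<lambda>i. ?X i \<omega>) {1..n} i)) \<le> c}"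
  proof (rule sign_coupling)
    show "indep_vars (\<lambda>_. borel) ?X {1..n}"
      by (rule indep_vars_compose2[OF indep]) measurable
    fix i assume i: "i \<in> {1..n}"
    have [measurable]: "Y i \<in> borel_measurable M" using i by (rule meas)
    have "prob {\<omega> \<in> space M. ?X i \<omega> = 1} = prob (space M - {\<omega> \<in> space M. F i \<le> Y i \<omega>})"
      by (intro arg_cong[where f=prob]) (auto simp: sgn_if)
    also have "\<dots> = 1 - prob {\<omega> \<in> space M. F i \<le> Y i \<omega>}"
      by (rule prob_compl) measurable
    finally show "prob {\<omega> \<in> space M. ?X i \<omega> = 1} \<le> 1 / 2"
      using med[OF i] by (simp add: is_median_def)
    have "prob {\<omega> \<in> space M. ?X i \<omega> = -1} = prob (space M - {\<omega> \<in> space M. Y i \<omega> \<le> F i})"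
      by (intro arg_cong[where f=prob]) (auto simp: sgn_if)
    also have "\<dots> = 1 - prob {\<omega> \<in> space M. Y i \<omega> \<le> F i}"
      by (rule prob_compl) measurable
    finally show "prob {\<omega> \<in> space M. ?X i \<omega> = -1} \<le> 1 / 2"
      using med[OF i] by (simp add: is_median_def)
  next
    fix \<tau> \<sigma> :: "nat \<Rightarrow> real"
    assume compat: "\<And>i. i \<in> {1..n} \<Longrightarrow> \<tau> i = 0 \<or> \<tau> i = \<sigma> i" and c: "T_stat n (\<lambda>i. ereal (\<sigma> i)) \<le> c"
    have "T_stat n (\<lambda>i. ereal (\<tau> i)) \<le> T_stat n (\<lambda>i. ereal (\<sigma> i))"
      by (rule T_stat_mono[OF assms(1)]) (use compat in \<open>force simp: sign_low_eq\<close>)+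
    then show "T_stat n (\<lambda>i. ereal (\<tau> i)) \<le> c" using c by (rule order_trans)
  qed (use assms(1) in \<open>auto simp: sgn_if\<close>)
  then show ?thesis unfolding T_sgn rademacher_vec_def .
qed

theorem mainTheorem2:
  fixes M :: "'a measure" and n :: nat and x :: "nat \<Rightarrow> real"
    and Y :: "nat \<Rightarrow> 'a \<Rightarrow> real" and f :: "real \<Rightarrow> ereal" and \<alpha> :: real
  assumes "prob_space M"
    and "n \<ge> 1"
    and "mono_on {1..n} x"
    and "prob_space.indep_vars M (\<lambda>_. borel) Y {1..n}"
    and "convex_fun f"
    and "\<forall>i\<in>{1..n}. is_median M (Y i) (f (x i))"
    and "0 < \<alpha>" and "\<alpha> < 1"
  shows "measure M {\<omega> \<in> space M.
            \<forall>t. L_hat n \<alpha> x (\<lambda>i. Y i \<omega>) t \<le> f t \<and> f t \<le> U_hat n \<alpha> x (\<lambda>i. Y i \<omega>) t}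
         \<ge> 1 - \<alpha>"
proof -
  interpret prob_space M by fact
  define F where "F i = real_of_ereal (f (x i))" for i
  have F: "f (x i) = ereal (F i)" if i: "i \<in> {1..n}" for i
    using median_real[OF bspec[OF assms(6) i]] by (metis F_def real_of_ereal.simps(1))
  have meas: "random_variable borel (Y i)" if "i \<in> {1..n}" for i
    using assms(4) that by (auto simp: indep_vars_def)
  have stat: "T_stat n (\<lambda>i. f (x i) - ereal (y i)) = T_stat n (\<lambda>i. ereal (F i - y i))" for y
    by (intro antisym T_stat_mono[OF assms(2)]) (simp_all add: F)
  have "1 - \<alpha> \<le> measure_pmf.prob (rademacher_vec n) {\<xi>. T_stat n (\<lambda>i. ereal (\<xi> i)) \<le> kappa n \<alpha>}"
    using assms(7,8) by (rule kappa_covers)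
  also have "\<dots> \<le> prob {\<omega> \<in> space M. T_stat n (\<lambda>i. ereal (F i - Y i \<omega>)) \<le> kappa n \<alpha>}"
    using assms(6) by (intro T_stat_quantile[OF assms(2,4)]) (simp add: F[symmetric])
  also have "\<dots> \<le> prob {\<omega> \<in> space M.
      \<forall>t. L_hat n \<alpha> x (\<lambda>i. Y i \<omega>) t \<le> f t \<and> f t \<le> U_hat n \<alpha> x (\<lambda>i. Y i \<omega>) t}"
  proof (rule finite_measure_mono)
    show "{\<omega> \<in> space M. T_stat n (\<lambda>i. ereal (F i - Y i \<omega>)) \<le> kappa n \<alpha>} \<subseteq> {\<omega> \<in> space M.
      \<forall>t. L_hat n \<alpha> x (\<lambda>i. Y i \<omega>) t \<le> f t \<and> f t \<le> U_hat n \<alpha> x (\<lambda>i. Y i \<omega>) t}"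
      using band_covers[OF assms(5)] by (auto simp: stat[symmetric])
  qed (use meas in \<open>rule coverage_event[OF assms(2)]\<close>)
  finally show ?thesis .
qed

end
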